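(* Let $\mathbf{M}$ be a matroid with ground set $E$ and basis family $\mathcal{B}$, and let $w\colon E \to \mathbb{R}$ be a weight function, with $w(S)=\sum_{e\in S}w(e)$. Let $B_0, B_1, \dotsc, B_k$ be a sequence of bases with $|B_i \setminus B_{i-1}| \le 1$ for all $1 \le i \le k$. For $1\le i\le k$ define $\mathrm{err}(B_i \mid B_{i-1}) := \max\{w(B) : B \in \mathcal{B}, |B \setminus B_{i-1}| \le 1\} - w(B_i)$ (which is $\ge 0$). Then $$w(B_k) \ge \max\{w(B) : B \in \mathcal{B},\ |B \setminus B_0| \le k\} - \sum_{i=1}^k \mathrm{err}(B_i \mid B_{i-1}).$$ *)

theory Defs
  imports Complex_Main
begin

text \<open>
  A (finite) matroid, given by its ground set \<open>E\<close> and its family of bases \<open>\<B>\<close>,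
  axiomatized by non-emptiness and basis exchange.
\<close>

locale matroid =
  fixes E :: "'a set" and \<B> :: "'a set set"
  assumes finite_ground: "finite E"
    and bases_subset: "B \<in> \<B> \<Longrightarrow> B \<subseteq> E"
    and bases_nonempty: "\<B> \<noteq> {}"
    and basis_exchange:
      "\<lbrakk>A \<in> \<B>; B \<in> \<B>; x \<in> A - B\<rbrakk> \<Longrightarrow> \<exists>y \<in> B - A. insert y (A - {x}) \<in> \<B>"

text \<open>
  \<open>err \<B> w B A\<close> is err(B | A).  The maximum is over a finite set, which is non-empty
  as soon as \<open>A \<in> \<B>\<close>.
\<close>

definition err :: "'a set set \<Rightarrow> ('a \<Rightarrow> real) \<Rightarrow> 'a set \<Rightarrow> 'a set \<Rightarrow> real" where
  "err \<B> w B A = Max {sum w B' |B'. B' \<in> \<B> \<and> card (B' - A) \<le> 1} - sum w B"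

end

theory Submission
  imports Defs
begin

text \<open>
  It suffices to show that if \<open>A'\<close> is at distance at most one from \<open>A\<close>, and \<open>C\<close> at distance at
  most \<open>k + 1\<close> from \<open>A\<close>, then there are bases \<open>D\<close> and \<open>F\<close>, at distance at most \<open>k\<close> from \<open>A'\<close> and at
  most one from \<open>A\<close>, with \<open>w(C) + w(A') \<le> w(D) + w(F)\<close>; the theorem then telescopes. A single
  symmetric exchange between \<open>C\<close> and \<open>A'\<close> produces \<open>D\<close> and \<open>F\<close> unless \<open>A' = A - a + b\<close> moves away
  from \<open>C\<close>. In that case two consecutive exchanges work, unless they amount to swapping \<open>a\<close> and
  \<open>b\<close>. Then \<open>C - a + b\<close> is a basis and no exchange preserving the multiset union need exist, but
  averaging exchanges over a matching from \<open>A\<close> to \<open>C\<close>, and over another one from \<open>C - a + b\<close> to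
  \<open>A'\<close>, gives changes of weight whose lower bounds cancel.
\<close>

lemma sum_swap:
  fixes w :: "'a \<Rightarrow> real"
  assumes "finite A" "x \<in> A" "y \<notin> A"
  shows "sum w (insert y (A - {x})) = sum w A - w x + w y"
  using assms by (simp add: sum_diff1)

context matroid
begin

section \<open>Consequences of basis exchange\<close>

lemma finite_basis: "B \<in> \<B> \<Longrightarrow> finite B"
  using bases_subset finite_ground finite_subset by blast

lemma finite_bases: "finite \<B>"
  using bases_subset finite_ground by (meson PowI finite_Pow_iff finite_subset subsetI)

lemma basis_antichain:
  assumes "A \<in> \<B>" "B \<in> \<B>" "A \<subseteq> B"
  shows "A = B"
  using basis_exchange[of B A] assms by blast

text \<open>Trading an element of \<open>A - B\<close> for one of \<open>B - A\<close> keeps the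
  size of \<open>A\<close> and shrinks \<open>A - B\<close>; once that is empty, \<open>A\<close>
  and \<open>B\<close> coincide.\<close>

lemma card_basis_eq:
  assumes "A \<in> \<B>" "B \<in> \<B>"
  shows "card A = card B"
  using assms(1)
proof (induction "card (A - B)" arbitrary: A)
  case 0
  then show ?case
    using basis_antichain[OF _ assms(2)] finite_basis by auto
next
  case (Suc n)
  have fin: "finite A" using Suc finite_basis by blast
  obtain x where x: "x \<in> A - B"
    using Suc.hyps(2) by (metis card.empty ex_in_conv old.nat.distinct(2))
  then obtain y where y: "y \<in> B - A" "insert y (A - {x}) \<in> \<B>"
    using basis_exchange Suc.prems assms(2) by blast
  have "insert y (A - {x}) - B = (A - B) - {x}"
    using y by blast
  then have "n = card (insert y (A - {x}) - B)"
    using x Suc.hyps(2) fin by simp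
  then have "card (insert y (A - {x})) = card B"
    using Suc.hyps(1) y(2) by blast
  moreover have "card (insert y (A - {x})) = card A"
    using fin x y card_Suc_Diff1[of A x] by simp
  ultimately show ?case by simp
qed

lemma card_basis_diff_commute:
  assumes "A \<in> \<B>" "B \<in> \<B>"
  shows "card (A - B) = card (B - A)"
proof -
  have "finite A" "finite B" "card A = card B"
    using assms finite_basis card_basis_eq by blast+
  then show ?thesis
    by (simp add: card_Diff_subset_Int Int_commute)
qed

text \<open>Elements of \<open>T\<close> outside \<open>X \<union> B\<close> are exchanged one by
  one for elements of \<open>B\<close>, so \<open>X\<close> is never touched.\<close>

lemma independent_extend_into:
  assumes "T \<in> \<B>" "B \<in> \<B>" "X \<subseteq> T"
  obtains T' where "T' \<in> \<B>" "X \<subseteq> T'" "T' \<subseteq> X \<union> B"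
proof -
  have "\<exists>T'\<in>\<B>. X \<subseteq> T' \<and> T' \<subseteq> X \<union> B"
    using assms(1,3)
  proof (induction "card (T - (X \<union> B))" arbitrary: T)
    case 0
    then show ?case
      using finite_basis by auto
  next
    case (Suc n)
    obtain t where t: "t \<in> T - (X \<union> B)"
      using Suc.hyps(2) by (metis card.empty ex_in_conv old.nat.distinct(2))
    then obtain u where u: "u \<in> B - T" "insert u (T - {t}) \<in> \<B>"
      using basis_exchange[of T B t] Suc.prems assms(2) by blast
    have "insert u (T - {t}) - (X \<union> B) = (T - (X \<union> B)) - {t}"
      using u by blast
    then have "n = card (insert u (T - {t}) - (X \<union> B))"
      using t Suc.hyps(2) finite_basis[OF Suc.prems(1)] by simp
    moreover have "X \<subseteq> insert u (T - {t})"
      using t Suc.prems by blast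
    ultimately show ?case
      using Suc.hyps(1) u(2) by blast
  qed
  then show ?thesis using that by blast
qed

text \<open>\<open>S\<close> extends to a basis \<open>T\<close> inside \<open>S \<union> A\<close>,
  which misses \<open>x\<close> because \<open>insert x S\<close> is dependent. Exchanging
  \<open>x\<close> out of \<open>A\<close> against \<open>T\<close> thus yields a \<open>y\<close>
  in \<open>S\<close>, and this membership is the second exchange.\<close>

lemma symmetric_exchange:
  assumes A: "A \<in> \<B>" and B: "B \<in> \<B>" and x: "x \<in> A - B"
  obtains y where "y \<in> B - A" "insert y (A - {x}) \<in> \<B>" "insert x (B - {y}) \<in> \<B>"
proof -
  \<comment> \<open>\<open>S\<close> is the fundamental circuit of \<open>x\<close> with respect to \<open>B\<close>, without \<open>x\<close> itself\<close>
  define S where "S = {y \<in> B. insert x (B - {y}) \<in> \<B>}"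
  \<comment> \<open>Extending \<open>insert x S\<close> within \<open>B\<close> gives a basis of the
    form \<open>insert x (B - {u})\<close>; then \<open>u\<close> lies in \<open>S\<close> and yet
    outside that basis.\<close>
  have dep: False if T: "T \<in> \<B>" "insert x S \<subseteq> T" for T
  proof -
    obtain T' where T': "T' \<in> \<B>" "insert x S \<subseteq> T'" "T' \<subseteq> insert x S \<union> B"
      using independent_extend_into[OF T(1) B T(2)] by blast
    obtain u where u: "u \<in> B - T'" "insert u (T' - {x}) \<in> \<B>"
      using basis_exchange[OF T'(1) B, of x] T'(2) x by blast
    have "insert u (T' - {x}) \<subseteq> B"
      using u T'(3) by (auto simp: S_def)
    then have "insert u (T' - {x}) = B"
      using basis_antichain u(2) B by blast
    then have "T' = insert x (B - {u})"
      using u(1) T'(2) by blast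
    then have "u \<in> S" using T'(1) u(1) by (auto simp: S_def)
    then show False using T'(2) u(1) by blast
  qed
  have "S \<subseteq> B" by (auto simp: S_def)
  then obtain T where T: "T \<in> \<B>" "S \<subseteq> T" "T \<subseteq> S \<union> A"
    using independent_extend_into[OF B A] by blast
  have "x \<notin> T" using dep T by blast
  then obtain y where y: "y \<in> T - A" "insert y (A - {x}) \<in> \<B>"
    using basis_exchange[OF A T(1), of x] x by blast
  then have "y \<in> S" using T(3) by blast
  then show ?thesis using that y by (auto simp: S_def)
qed

text \<open>
  Symmetric exchanges moving \<open>C\<close> to \<open>A\<close> match \<open>A - C\<close> with \<open>C - A\<close> by pairs that can be exchanged
  in \<open>A\<close>; the best pair is at least as good as the average one.
\<close>

lemma averaging_exchange:
  fixes w :: "'a \<Rightarrow> real"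
  assumes "A \<in> \<B>" "C \<in> \<B>" "card (C - A) = Suc n"
  obtains x y where "x \<in> A - C" "y \<in> C - A" "insert y (A - {x}) \<in> \<B>"
    "sum w C - sum w A \<le> real (Suc n) * (w y - w x)"
proof -
  have "\<exists>x\<in>A - C. \<exists>y\<in>C - A. insert y (A - {x}) \<in> \<B> \<and>
      sum w C - sum w A \<le> real (Suc n) * (w y - w x)"
    using assms(2,3)
  proof (induction n arbitrary: C)
    case 0
    obtain y where y: "y \<in> C - A"
      using 0(2) by (metis card.empty ex_in_conv old.nat.distinct(2))
    obtain x where x: "x \<in> A - C" "insert x (C - {y}) \<in> \<B>" "insert y (A - {x}) \<in> \<B>"
      using symmetric_exchange[OF 0(1) assms(1) y] by blast
    have "C - A = {y}" using 0 y by (metis One_nat_def card_1_singletonE singletonD)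
    then have "insert x (C - {y}) \<subseteq> A" using x by blast
    then have "insert x (C - {y}) = A" using basis_antichain x assms(1) by blast
    moreover have "sum w (insert x (C - {y})) = sum w C - w y + w x"
      using sum_swap[of C y x w] finite_basis 0 x y by blast
    ultimately show ?case using x y by force
  next
    case (Suc n)
    obtain y where y: "y \<in> C - A"
      using Suc.prems(2) by (metis card.empty ex_in_conv old.nat.distinct(2))
    obtain x where x: "x \<in> A - C" "insert x (C - {y}) \<in> \<B>" "insert y (A - {x}) \<in> \<B>"
      using symmetric_exchange[OF Suc.prems(1) assms(1) y] by blast
    define C' where "C' = insert x (C - {y})"
    have eq: "C' - A = (C - A) - {y}" using x unfolding C'_def by blast
    have "card (C' - A) = Suc n"
      using y Suc.prems finite_basis[OF Suc.prems(1)] by (simp add: eq)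
    then obtain x' y' where xy: "x' \<in> A - C'" "y' \<in> C' - A" "insert y' (A - {x'}) \<in> \<B>"
        "sum w C' - sum w A \<le> real (Suc n) * (w y' - w x')"
      using Suc.IH[of C'] x by (auto simp: C'_def)
    \<comment> \<open>All pairs are exchanges in the fixed basis \<open>A\<close>, so a pair found
      for \<open>C'\<close> also serves for \<open>C\<close>.\<close>
    have sub: "x' \<in> A - C" "y' \<in> C - A"
      using xy y x unfolding C'_def by blast+
    have "sum w C' = sum w C - w y + w x"
      using sum_swap[of C y x w] finite_basis Suc.prems x y unfolding C'_def by blast
    then have *: "sum w C - sum w A \<le> real (Suc n) * (w y' - w x') + (w y - w x)"
      using xy(4) by linarith
    show ?case
    proof (cases "w y' - w x' \<le> w y - w x")
      case True
      then have "real (Suc n) * (w y' - w x') \<le> real (Suc n) * (w y - w x)"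
        by (intro mult_left_mono) auto
      then have "sum w C - sum w A \<le> real (Suc (Suc n)) * (w y - w x)"
        using * by (simp add: algebra_simps)
      then show ?thesis using x y by blast
    next
      case False
      then have "sum w C - sum w A \<le> real (Suc (Suc n)) * (w y' - w x')"
        using * by (simp add: algebra_simps)
      then show ?thesis using xy sub by blast
    qed
  qed
  then show ?thesis using that by blast
qed

section \<open>Exchange inequality along one step from \<open>A\<close> to \<open>A'\<close>\<close>

lemma swap_towards:
  assumes "C \<in> \<B>" "x \<in> A" "y \<in> C - A" "card (C - A) \<le> Suc k"
  shows "card (insert x (C - {y}) - A) \<le> k"
proof -
  have "insert x (C - {y}) - A = (C - A) - {y}" using assms by blast
  then show ?thesis using assms finite_basis by simp
qed

lemma card_swap_diff_le_1: "card (insert y (A - {x}) - A) \<le> 1"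
proof -
  have "card (insert y (A - {x}) - A) \<le> card {y}" by (intro card_mono) auto
  then show ?thesis by simp
qed

text \<open>Here \<open>C - A'\<close> has \<open>k + 2\<close> elements, too many for one exchange.
  The first exchange takes \<open>b\<close> out of \<open>A'\<close>, the second puts
  \<open>a\<close> back.\<close>

lemma two_step_exchange:
  fixes w :: "'a \<Rightarrow> real"
  assumes A: "A \<in> \<B>" and A': "A' \<in> \<B>" and C: "C \<in> \<B>"
    and A'_eq: "A' = insert b (A - {a})" and a: "a \<in> A" "a \<in> C" and b: "b \<notin> A" "b \<notin> C"
    and card: "card (C - A) = Suc k"
  shows "\<exists>D\<in>\<B>. \<exists>F\<in>\<B>. card (D - A') \<le> k \<and> card (F - A) \<le> 1 \<and>
    sum w C + sum w A' \<le> sum w D + sum w F"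
proof -
  have fin: "finite A" "finite A'" "finite C" using A A' C finite_basis by blast+
  have ab: "a \<noteq> b" using a b by blast
  have wA': "sum w A' = sum w A - w a + w b"
    using sum_swap[of A a b w] fin a b A'_eq by blast
  have "b \<in> A' - C" using A'_eq b by blast
  then obtain y where y: "y \<in> C - A'" "insert y (A' - {b}) \<in> \<B>" "insert b (C - {y}) \<in> \<B>"
    using symmetric_exchange[OF A' C] by blast
  \<comment> \<open>The first alternative covers both \<open>y = a\<close> and a second exchange
    that returns \<open>y\<close> to \<open>C\<close>.\<close>
  consider "insert b (C - {a}) \<in> \<B>"
    | x where "y \<noteq> a" "x \<in> A - {a}" "x \<notin> C" "insert a (insert y (A' - {b}) - {x}) \<in> \<B>"
        "insert x (insert b (C - {y}) - {a}) \<in> \<B>"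
  proof (cases "y = a")
    case True
    then show ?thesis using that y by blast
  next
    case False
    define A1 where "A1 = insert y (A' - {b})"
    define C1 where "C1 = insert b (C - {y})"
    have "a \<in> C1 - A1"
      using False a ab A'_eq unfolding A1_def C1_def by blast
    then obtain x where x: "x \<in> A1 - C1" "insert x (C1 - {a}) \<in> \<B>" "insert a (A1 - {x}) \<in> \<B>"
      using symmetric_exchange[of C1 A1 a] y unfolding A1_def C1_def by blast
    show ?thesis
    proof (cases "x = y")
      case True
      then have "insert x (C1 - {a}) = insert b (C - {a})"
        using y False ab unfolding C1_def by blast
      then show ?thesis using that x by simp
    next
      case False': False
      have "x \<in> A - {a}" "x \<notin> C"
        using x False' A'_eq b unfolding A1_def C1_def by auto
      then show ?thesis using that(2)[of x] False x unfolding A1_def C1_def by blast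
    qed
  qed
  then show ?thesis
  proof cases
    case 1
    define C2 where "C2 = insert b (C - {a})"
    have C2: "C2 \<in> \<B>" using 1 unfolding C2_def .
    \<comment> \<open>\<open>C2\<close> and \<open>A'\<close> arise from \<open>C\<close> and
      \<open>A\<close> by the same swap of \<open>a\<close> for \<open>b\<close>, so their distance
      and weight difference are the same and the two averaged bounds are opposite.\<close>
    have "C2 - A' = C - A" using A'_eq a b unfolding C2_def by blast
    then have card2: "card (C2 - A') = Suc k" using card by simp
    then have card3: "card (A' - C2) = Suc k"
      using card_basis_diff_commute[OF A' C2] by simp
    have wC2: "sum w C2 = sum w C - w a + w b"
      using sum_swap[of C a b w] fin a b unfolding C2_def by blast
    obtain x y where xy: "x \<in> A - C" "y \<in> C - A" "insert y (A - {x}) \<in> \<B>"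
        "sum w C - sum w A \<le> real (Suc k) * (w y - w x)"
      using averaging_exchange[OF A C card] .
    obtain u v where uv: "u \<in> C2 - A'" "v \<in> A' - C2" "insert v (C2 - {u}) \<in> \<B>"
        "sum w A' - sum w C2 \<le> real (Suc k) * (w v - w u)"
      using averaging_exchange[OF C2 A' card3] .
    have "card (insert v (C2 - {u}) - A') \<le> k"
      using swap_towards[OF C2, of v A' u k] uv card2 by auto
    moreover have "sum w (insert y (A - {x})) = sum w A - w x + w y"
      using sum_swap[of A x y w] xy fin by blast
    moreover have "sum w (insert v (C2 - {u})) = sum w C2 - w u + w v"
      using sum_swap[of C2 u v w] uv finite_basis[OF C2] by blast
    moreover have "0 \<le> real (Suc k) * ((w y - w x) + (w v - w u))"
      unfolding distrib_left using xy(4) uv(4) wA' wC2 by linarith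
    then have "0 \<le> (w y - w x) + (w v - w u)"
      by (simp add: zero_le_mult_iff)
    ultimately have "sum w C + sum w A' \<le> sum w (insert v (C2 - {u})) + sum w (insert y (A - {x}))"
      using wA' wC2 by linarith
    then show ?thesis
      using uv(3) xy(3) \<open>card (insert v (C2 - {u}) - A') \<le> k\<close> card_swap_diff_le_1[of y A x]
      by (rule_tac bexI[of _ "insert v (C2 - {u})"], rule_tac bexI[of _ "insert y (A - {x})"]) simp_all
  next
    case (2 x)
    \<comment> \<open>Putting \<open>a\<close> back undoes the step from \<open>A\<close> to
      \<open>A'\<close>; only the swap of \<open>x\<close> for \<open>y\<close> remains.\<close>
    have F: "insert a (insert y (A' - {b}) - {x}) = insert y (A - {x})"
      using 2 A'_eq a b y by blast
    have yA: "y \<in> C - A" using y 2 A'_eq by blast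
    define D where "D = insert x (insert b (C - {y}) - {a})"
    have "D - A' = (C - A) - {y}"
      using 2 A'_eq a b unfolding D_def by blast
    then have "card (D - A') \<le> k" using card yA fin by simp
    moreover have "sum w (insert b (C - {y})) = sum w C - w y + w b"
      using sum_swap[of C y b w] fin yA b by blast
    moreover have "sum w D = sum w (insert b (C - {y})) - w a + w x"
      unfolding D_def using sum_swap[of "insert b (C - {y})" a x w] fin 2 a b by blast
    moreover have "sum w (insert y (A - {x})) = sum w A - w x + w y"
      using sum_swap[of A x y w] fin 2 yA by blast
    moreover have "D \<in> \<B>" "insert y (A - {x}) \<in> \<B>"
      using 2 F unfolding D_def by simp_all
    ultimately show ?thesis
      using wA' card_swap_diff_le_1[of y A x]
      by (rule_tac bexI[of _ D], rule_tac bexI[of _ "insert y (A - {x})"]) simp_all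
  qed
qed

text \<open>The distance from \<open>C\<close> to \<open>A'\<close> decides: up to \<open>k\<close>,
  take \<open>D = C\<close> and \<open>F = A'\<close>; at \<open>k + 1\<close> one exchange
  suffices; \<open>k + 2\<close> is the case of \<open>two_step_exchange\<close>.\<close>

lemma weight_exchange:
  fixes w :: "'a \<Rightarrow> real"
  assumes A: "A \<in> \<B>" and A': "A' \<in> \<B>" and C: "C \<in> \<B>"
    and near: "card (A' - A) \<le> 1" and card: "card (C - A) \<le> Suc k"
  shows "\<exists>D\<in>\<B>. \<exists>F\<in>\<B>. card (D - A') \<le> k \<and> card (F - A) \<le> 1 \<and>
    sum w C + sum w A' \<le> sum w D + sum w F"
proof -
  have fin: "finite A" "finite A'" "finite C" using A A' C finite_basis by blast+
  \<comment> \<open>a symmetric exchange between \<open>C\<close> and \<open>A'\<close> preserves the total weight\<close>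
  have single: ?thesis
    if "y \<in> C - A'" "x \<in> A' - C" "insert x (C - {y}) \<in> \<B>" "insert y (A' - {x}) \<in> \<B>"
      "card (C - A') \<le> Suc k" "card (insert y (A' - {x}) - A) \<le> 1" for x y
  proof -
    have "sum w (insert x (C - {y})) = sum w C - w y + w x"
      "sum w (insert y (A' - {x})) = sum w A' - w x + w y"
      using sum_swap[of C y x w] sum_swap[of A' x y w] that(1,2) fin by blast+
    then show ?thesis
      using that swap_towards[OF C, of x A' y k]
      by (rule_tac bexI[of _ "insert x (C - {y})"], rule_tac bexI[of _ "insert y (A' - {x})"]) simp_all
  qed
  show ?thesis
  proof (cases "card (C - A') \<le> k")
    case True
    then show ?thesis using C A' near by blast
  next
    case far: False
    show ?thesis
    proof (cases "A' = A")
      case True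
      obtain y where y: "y \<in> C - A'"
        using far by (metis card.empty ex_in_conv zero_le)
      obtain x where x: "x \<in> A' - C" "insert x (C - {y}) \<in> \<B>" "insert y (A' - {x}) \<in> \<B>"
        using symmetric_exchange[OF C A' y] by blast
      then show ?thesis
        using single[OF y x] True card card_swap_diff_le_1[of y A x] by simp
    next
      case False
      then have "\<not> A' \<subseteq> A" using basis_antichain A A' by blast
      then have "card (A' - A) = 1"
        using near fin by (metis Diff_eq_empty_iff card_0_eq finite_Diff le_antisym less_one not_le)
      moreover then have "card (A - A') = 1"
        using card_basis_diff_commute A A' by simp
      ultimately obtain a b where ab: "A' - A = {b}" "A - A' = {a}"
        by (metis card_1_singletonE)
      have A'_eq: "A' = insert b (A - {a})" and aA: "a \<in> A" and bA: "b \<notin> A"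
        using ab by blast+
      show ?thesis
      proof (cases "card (C - A') \<le> Suc k")
        case le: True
        show ?thesis
        proof (cases "b \<in> C")
          case True
          \<comment> \<open>Containing \<open>b\<close> but not \<open>a\<close>, \<open>C\<close>
            would be within \<open>k\<close> of \<open>A'\<close>. So \<open>a\<close> can be
            returned to \<open>A'\<close>, which leaves at most \<open>b\<close> outside
            \<open>A\<close>.\<close>
          have "a \<in> C"
          proof (rule ccontr)
            assume "a \<notin> C"
            then have "C - A' = (C - A) - {b}" using A'_eq by blast
            then show False using far card True bA fin by simp
          qed
          then have a: "a \<in> C - A'" using ab by blast
          obtain x where x: "x \<in> A' - C" "insert x (C - {a}) \<in> \<B>" "insert a (A' - {x}) \<in> \<B>"
            using symmetric_exchange[OF C A' a] by blast
          have "card (insert a (A' - {x}) - A) \<le> card {b}"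
            using A'_eq aA by (intro card_mono) auto
          then show ?thesis using single[OF a x] le by simp
        next
          case False
          \<comment> \<open>Removing \<open>b\<close> from \<open>A'\<close> leaves
            \<open>A - {a}\<close>, so whichever \<open>y\<close> enters, the result is within one
            of \<open>A\<close>.\<close>
          then have "b \<in> A' - C" using A'_eq by blast
          then obtain y where y: "y \<in> C - A'" "insert y (A' - {b}) \<in> \<B>" "insert b (C - {y}) \<in> \<B>"
            using symmetric_exchange[OF A' C] by blast
          have "card (insert y (A' - {b}) - A) \<le> card {y}"
            using A'_eq by (intro card_mono) auto
          then show ?thesis using single[OF y(1) \<open>b \<in> A' - C\<close> y(3,2)] le by simp
        qed
      next
        case False
        \<comment> \<open>At distance above \<open>k + 1\<close>, the step to \<open>A'\<close> must
          lose an element of \<open>C\<close> and gain none.\<close>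
        have "C - A' \<subseteq> insert a (C - A - {b})" using A'_eq by blast
        then have le: "card (C - A') \<le> Suc (card (C - A - {b}))"
          using fin card_mono[of "insert a (C - A - {b})" "C - A'"]
          by (simp add: card_insert_if split: if_splits)
        have b: "b \<notin> C"
        proof
          assume "b \<in> C"
          then have "card (C - A - {b}) \<le> k" using card bA fin by simp
          then show False using le False by linarith
        qed
        have a: "a \<in> C"
        proof (rule ccontr)
          assume "a \<notin> C"
          then have "C - A' = C - A" using A'_eq b by blast
          then show False using False card by simp
        qed
        have "C - A - {b} = C - A" using b by blast
        then have "card (C - A) = Suc k" using le False card by simp
        then show ?thesis
          using two_step_exchange[OF A A' C A'_eq aA a bA b] by blast
      qed
    qed
  qed
qed

section \<open>Errors and telescoping\<close>

lemma finite_weights: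
  "finite {sum w B' |B'. B' \<in> \<B> \<and> P B'}"
  using finite_bases by simp

lemma weight_le_err:
  assumes "F \<in> \<B>" "card (F - A) \<le> 1"
  shows "sum w F \<le> sum w B + err \<B> w B A"
  unfolding err_def using assms Max_ge[OF finite_weights] by fastforce

text \<open>The induction shifts the sequence by one: \<open>C\<close> is traded for a
  \<open>D\<close> within \<open>k\<close> of \<open>B 1\<close>, at a loss of at most
  \<open>sum w F - sum w (B 1)\<close>, which the first error bounds.\<close>

lemma weight_le_sum_err:
  assumes "\<forall>i\<in>{0..k}. B i \<in> \<B>" "\<forall>i\<in>{1..k}. card (B i - B (i - 1)) \<le> 1"
    and "C \<in> \<B>" "card (C - B 0) \<le> k"
  shows "sum w C \<le> sum w (B k) + (\<Sum>i=1..k. err \<B> w (B i) (B (i - 1)))"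
  using assms
proof (induction k arbitrary: B C)
  case 0
  then have "C \<subseteq> B 0" using finite_basis by auto
  then have "C = B 0" using 0 basis_antichain by simp
  then show ?case by simp
next
  case (Suc k)
  have B01: "B 0 \<in> \<B>" "B 1 \<in> \<B>" "card (B 1 - B 0) \<le> 1"
    using Suc.prems(1,2) by force+
  obtain D F where DF: "D \<in> \<B>" "F \<in> \<B>" "card (D - B 1) \<le> k" "card (F - B 0) \<le> 1"
      "sum w C + sum w (B 1) \<le> sum w D + sum w F"
    using weight_exchange[OF B01(1,2) Suc.prems(3) B01(3) Suc.prems(4)] by blast
  have near: "\<forall>i\<in>{1..k}. card (B (Suc i) - B (Suc (i - 1))) \<le> 1"
  proof
    fix i assume i: "i \<in> {1..k}"
    then have "card (B (Suc i) - B (Suc i - 1)) \<le> 1"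
      using Suc.prems(2) by (metis atLeastAtMost_iff le_SucI Suc_le_mono)
    then show "card (B (Suc i) - B (Suc (i - 1))) \<le> 1" using i by simp
  qed
  have "sum w D \<le> sum w (B (Suc k)) + (\<Sum>i=1..k. err \<B> w (B (Suc i)) (B (Suc (i - 1))))"
    using Suc.IH[of "\<lambda>i. B (Suc i)" D] Suc.prems(1) near DF by auto
  moreover have "(\<Sum>i=1..Suc k. err \<B> w (B i) (B (i - 1))) =
      err \<B> w (B 1) (B 0) + (\<Sum>i=1..k. err \<B> w (B (Suc i)) (B (Suc (i - 1))))"
  proof -
    have "(\<Sum>i=1..Suc k. err \<B> w (B i) (B (i - 1))) =
        err \<B> w (B 1) (B 0) + (\<Sum>i=Suc 1..Suc k. err \<B> w (B i) (B (i - 1)))"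
      by (subst sum.atLeast_Suc_atMost) auto
    then show ?thesis
      unfolding sum.shift_bounds_cl_Suc_ivl by simp
  qed
  moreover have "sum w F \<le> sum w (B 1) + err \<B> w (B 1) (B 0)"
    using weight_le_err DF by blast
  ultimately show ?case using DF(5) by linarith
qed

end

theorem theorem1p6:
  fixes E :: "'a set" and \<B> :: "'a set set" and w :: "'a \<Rightarrow> real"
    and B :: "nat \<Rightarrow> 'a set" and k :: nat
  assumes "matroid E \<B>"
    and "\<forall>i\<in>{0..k}. B i \<in> \<B>"
    and "\<forall>i\<in>{1..k}. card (B i - B (i - 1)) \<le> 1"
  shows "(\<forall>i\<in>{1..k}. err \<B> w (B i) (B (i - 1)) \<ge> 0) \<and>
    sum w (B k) \<ge> Max {sum w B' |B'. B' \<in> \<B> \<and> card (B' - B 0) \<le> k}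
      - (\<Sum>i=1..k. err \<B> w (B i) (B (i - 1)))"
proof -
  interpret matroid E \<B> by fact
  have "err \<B> w (B i) (B (i - 1)) \<ge> 0" if "i \<in> {1..k}" for i
    \<comment> \<open>\<open>B i\<close> itself competes in the maximum; with \<open>F\<close> and
      \<open>B\<close> both equal to it, the weights cancel.\<close>
    using weight_le_err[of "B i" "B (i - 1)" w "B i"] assms(2,3) that by simp
  moreover have "Max {sum w B' |B'. B' \<in> \<B> \<and> card (B' - B 0) \<le> k}
      \<le> sum w (B k) + (\<Sum>i=1..k. err \<B> w (B i) (B (i - 1)))"
  proof (rule Max.boundedI)
    show "{sum w B' |B'. B' \<in> \<B> \<and> card (B' - B 0) \<le> k} \<noteq> {}"
      using assms(2) by (auto intro!: exI[of _ "B 0"])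
  qed (use finite_weights weight_le_sum_err[OF assms(2,3)] in auto)
  ultimately show ?thesis by (simp add: algebra_simps)
qed

end
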